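(* Let $Q\in\mathbb{R}^{n\times n}$ be a nonzero positive semidefinite matrix, let $c\in\mathbb{R}^n$, and let $f(x)=\frac12 x^TQx+c^Tx$ for $x\in\mathbb{R}^n$. Assume that there is a vector $x_*$ minimizing $f$ on $\mathbb{R}^n$ and denote $f_*=f(x_* )$. Then, for every starting point $x_0\in\mathbb{R}^n$, every sequence $(x_i)_{i\ge0}$ generated by the gradient method with exact line search applied to $f$ satisfies $$f(x_{i+1})-f_*\leq \left(1-\frac{\lambda^{++}_{\min}(Q)}{\lambda_{\max}(Q)}\right)^2\bigl(f(x_i)-f_*\bigr),\qquad i=0,1,2,\dots,$$ where $\lambda^{++}_{\min}(Q)$ is the smallest strictly positive eigenvalue of $Q$ and $\lambda_{\max}(Q)$ is the largest eigenvalue of $Q$.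
   Context: Positive semidefinite matrices are understood to be real symmetric. The gradient method with exact line search (Cauchy algorithm) applied to a function $f:\mathbb{R}^n\to\mathbb{R}$ from a starting point $x_0\in\mathbb{R}^n$ generates iterates as follows: for $i=0,1,2,\dots$, choose $\gamma_i\in\arg\min_{\gamma\in\mathbb{R}} f(x_i-\gamma\nabla f(x_i))$ and set $x_{i+1}=x_i-\gamma_i\nabla f(x_i)$. *)

theory Defs
  imports "HOL-Analysis.Analysis"
begin

definition positive_semidefinite :: "real ^ 'n ^ 'n \<Rightarrow> bool" where
  "positive_semidefinite A \<longleftrightarrow> transpose A = A \<and> (\<forall>v. 0 \<le> v \<bullet> (A *v v))"

definition eigenvalues :: "real ^ 'n ^ 'n \<Rightarrow> real set" where
  "eigenvalues A = {l. \<exists>v. v \<noteq> 0 \<and> A *v v = l *\<^sub>R v}"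

(* Eigenvalue sets are finite. For a symmetric matrix the set in lambda_max is also nonempty;
   the one in lambda_min_pos is nonempty as soon as the matrix has a positive eigenvalue,
   e.g. if it is nonzero and positive semidefinite. Otherwise the values are unspecified. *)

definition lambda_max :: "real ^ 'n ^ 'n \<Rightarrow> real" where
  "lambda_max A = Max (eigenvalues A)"

definition lambda_min_pos :: "real ^ 'n ^ 'n \<Rightarrow> real" where
  "lambda_min_pos A = Min {l \<in> eigenvalues A. 0 < l}"

(* Meaningful only where f is differentiable. *)
definition gradient :: "('a::real_inner \<Rightarrow> real) \<Rightarrow> 'a \<Rightarrow> 'a" where
  "gradient f x = (THE g. GDERIV f x :> g)"

(* A relation rather than a function: the exact line search need not have a unique minimizer
   (where the gradient vanishes, every step size is one). *)
definition exact_line_search_sequence ::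
    "('a::real_inner \<Rightarrow> real) \<Rightarrow> 'a \<Rightarrow> (nat \<Rightarrow> 'a) \<Rightarrow> bool" where
  "exact_line_search_sequence f x0 x \<longleftrightarrow>
     x 0 = x0 \<and>
     (\<forall>i. \<exists>\<gamma>::real.
        is_arg_min (\<lambda>t. f (x i - t *\<^sub>R gradient f (x i))) (\<lambda>_. True) \<gamma> \<and>
        x (Suc i) = x i - \<gamma> *\<^sub>R gradient f (x i))"

end

theory Submission
  imports Defs
begin

text \<open>
  Put \<open>\<mu> = lambda_min_pos Q\<close>, \<open>L = lambda_max Q\<close>, \<open>r = 1 - \<mu> / L\<close> and
  \<open>T = I - Q / L\<close>. Since \<open>Q xstar + c = 0\<close>, the excess \<open>f y - f xstar\<close> is half the quadratic form
  of \<open>Q\<close> at the error \<open>y - xstar\<close>, and the gradient at \<open>y\<close> is \<open>Q (y - xstar)\<close>. Exact line search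
  does at least as well as the fixed step \<open>1 / L\<close>, which replaces the error \<open>e\<close> by \<open>T e\<close>. So it is
  enough that \<open>T e \<bullet> Q (T e) \<le> r\<^sup>2 * (e \<bullet> Q e)\<close>, in other words that \<open>M = r\<^sup>2 Q - Q T T\<close> is positive
  semidefinite. On an eigenvector of \<open>Q\<close> with eigenvalue \<open>l\<close>, the operator \<open>M\<close> acts as
  \<open>l (r\<^sup>2 - (1 - l / L)\<^sup>2)\<close>, which vanishes for \<open>l = 0\<close> and is nonnegative for \<open>\<mu> \<le> l \<le> L\<close>.

  Passing from the eigenvectors of \<open>Q\<close> to all vectors does not take a full diagonalization. The
  minimum of the Rayleigh quotient of \<open>M\<close> is an eigenvalue of \<open>M\<close>
  (\<open>selfadjoint_min_eigenvector\<close>); as \<open>Q\<close> commutes with \<open>M\<close>, it preserves the corresponding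
  eigenspace and so has an eigenvector in it. Hence this minimum is attained at a common eigenvector
  (\<open>commuting_selfadjoint_nonneg\<close>), where its sign is known.
\<close>

section \<open>Self-adjoint operators\<close>

text \<open>
  First-order optimality of a quadratic along a line: for small \<open>t\<close> the linear term dominates, so it
  must vanish.
\<close>

lemma nonneg_quadratic_linear_term_zero:
  fixes a b :: real
  assumes nonneg: "\<And>t. 0 \<le> t * b + t\<^sup>2 * a"
  shows "b = 0"
proof (rule ccontr)
  assume "b \<noteq> 0"
  \<comment> \<open>The exact minimizer \<open>- b / (2 * a)\<close> needs \<open>0 < a\<close>; dividing by \<open>\<bar>a\<bar> + 1\<close> works for every \<open>a\<close>.\<close>
  define d where "d = \<bar>a\<bar> + 1"
  have d: "0 < d" "a - d < 0" by (auto simp: d_def)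
  define t where "t = - b / d"
  have b: "b = - (t * d)" using d by (simp add: t_def)
  have "t \<noteq> 0" using \<open>b \<noteq> 0\<close> d by (simp add: t_def)
  have "t * b + t\<^sup>2 * a = t\<^sup>2 * (a - d)"
    by (simp add: b algebra_simps power2_eq_square)
  also have "\<dots> < 0"
    using \<open>t \<noteq> 0\<close> d by (intro mult_pos_neg) auto
  finally show False
    using nonneg[of t] by simp
qed

text \<open>
  A minimizer of the quadratic form on the unit sphere of the subspace exists by compactness. At a
  minimizer \<open>v\<close> with value \<open>k\<close>, the form \<open>w \<bullet> f w - k * (w \<bullet> w)\<close> is nonnegative on the subspace and zero
  at \<open>v\<close>, so its derivative at \<open>v\<close> in the direction \<open>f v - k *\<^sub>R v\<close> vanishes; that derivative is
  twice the squared norm of this direction.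
\<close>

lemma selfadjoint_min_eigenvector:
  fixes f :: "'a::euclidean_space \<Rightarrow> 'a"
  assumes lin: "linear f"
    and selfadj: "\<And>x y. x \<bullet> f y = f x \<bullet> y"
    and sub: "subspace S"
    and inv: "\<And>x. x \<in> S \<Longrightarrow> f x \<in> S"
    and nonzero: "\<exists>x\<in>S. x \<noteq> 0"
  obtains v k where "v \<in> S" "v \<noteq> 0" "f v = k *\<^sub>R v"
    "\<And>x. x \<in> S \<Longrightarrow> k * (x \<bullet> x) \<le> x \<bullet> f x"
proof -
  interpret f: linear f by (fact lin)
  obtain u where u: "u \<in> S" "u \<noteq> 0" using nonzero by blast
  let ?K = "sphere 0 1 \<inter> S"
  have "compact ?K"
    using closed_subspace[OF sub] by (intro compact_Int_closed) auto
  moreover have "(1 / norm u) *\<^sub>R u \<in> ?K"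
    using u subspace_scale[OF sub] by simp
  then have "?K \<noteq> {}" by blast
  moreover have "continuous_on ?K (\<lambda>x. x \<bullet> f x)"
    using lin by (intro continuous_intros linear_continuous_on) (simp add: linear_conv_bounded_linear)
  ultimately obtain v where v: "v \<in> ?K" and vmin: "\<And>x. x \<in> ?K \<Longrightarrow> v \<bullet> f v \<le> x \<bullet> f x"
    using continuous_attains_inf[of ?K "\<lambda>x. x \<bullet> f x"] by blast
  define k where "k = v \<bullet> f v"
  have vS: "v \<in> S" and vv: "v \<bullet> v = 1"
    using v by (auto simp: dot_square_norm)
  have bound: "k * (x \<bullet> x) \<le> x \<bullet> f x" if "x \<in> S" for x
  proof (cases "x = 0")
    case True
    then show ?thesis by simp
  next
    case False
    have "(1 / norm x) *\<^sub>R x \<in> ?K"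
      using False that subspace_scale[OF sub] by simp
    from vmin[OF this] have "k \<le> (x \<bullet> f x) / (norm x)\<^sup>2"
      by (simp add: k_def f.scale power2_eq_square)
    then show ?thesis
      using False by (simp add: dot_square_norm pos_le_divide_eq)
  qed
  define w where "w = f v - k *\<^sub>R v"
  have wS: "w \<in> S"
    unfolding w_def using sub vS inv by (intro subspace_diff subspace_scale) auto
  have "2 * (w \<bullet> w) = 0"
  proof (rule nonneg_quadratic_linear_term_zero)
    fix t :: real
    have "v + t *\<^sub>R w \<in> S"
      using sub vS wS by (intro subspace_add subspace_scale)
    from bound[OF this]
    have "0 \<le> (v + t *\<^sub>R w) \<bullet> f (v + t *\<^sub>R w) - k * ((v + t *\<^sub>R w) \<bullet> (v + t *\<^sub>R w))"
      by simp
    also have "\<dots> = t * (2 * (f v \<bullet> w - k * (v \<bullet> w))) + t\<^sup>2 * (w \<bullet> f w - k * (w \<bullet> w))"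
      using selfadj[of v w] vv k_def
      by (simp add: f.add f.scale inner_simps inner_commute algebra_simps power2_eq_square)
    also have "f v \<bullet> w - k * (v \<bullet> w) = w \<bullet> w"
      by (simp add: w_def inner_diff_left)
    finally show "0 \<le> t * (2 * (w \<bullet> w)) + t\<^sup>2 * (w \<bullet> f w - k * (w \<bullet> w))" .
  qed
  then have "f v = k *\<^sub>R v" by (simp add: w_def)
  moreover have "v \<noteq> 0" using vv by auto
  ultimately show thesis using that vS bound by blast
qed

text \<open>
  The smallest eigenvalue of \<open>g\<close> has an eigenspace that \<open>f\<close> preserves, because the two commute; \<open>f\<close> has
  an eigenvector there. So positivity of \<open>g\<close> can be tested on common eigenvectors, which replaces a
  simultaneous diagonalization.
\<close>

lemma commuting_selfadjoint_nonneg: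
  fixes f g :: "'a::euclidean_space \<Rightarrow> 'a"
  assumes f: "linear f" "\<And>x y. x \<bullet> f y = f x \<bullet> y"
    and g: "linear g" "\<And>x y. x \<bullet> g y = g x \<bullet> y"
    and comm: "\<And>x. f (g x) = g (f x)"
    and eig: "\<And>v l k. v \<noteq> 0 \<Longrightarrow> f v = l *\<^sub>R v \<Longrightarrow> g v = k *\<^sub>R v \<Longrightarrow> 0 \<le> k"
  shows "0 \<le> x \<bullet> g x"
proof (cases "x = 0")
  case False
  interpret f: linear f by (fact f(1))
  interpret g: linear g by (fact g(1))
  obtain v k where v: "v \<noteq> 0" "g v = k *\<^sub>R v" and k: "\<And>y. k * (y \<bullet> y) \<le> y \<bullet> g y"
    using selfadjoint_min_eigenvector[OF g, of UNIV] False by auto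
  let ?E = "{y. g y = k *\<^sub>R y}"
  have "subspace ?E"
    by (auto simp: subspace_def g.add g.scale g.zero algebra_simps)
  moreover have "f y \<in> ?E" if "y \<in> ?E" for y
    using that comm[of y] by (simp add: f.scale)
  moreover have "\<exists>y\<in>?E. y \<noteq> 0" using v by blast
  ultimately obtain u l where "u \<in> ?E" "u \<noteq> 0" "f u = l *\<^sub>R u"
    by (rule selfadjoint_min_eigenvector[OF f]) blast
  then have "0 \<le> k" using eig by blast
  then have "0 \<le> k * (x \<bullet> x)" by simp
  with k[of x] show ?thesis by linarith
qed simp

section \<open>Eigenvalues of symmetric matrices\<close>

lemma symmetric_matrix_selfadjoint:
  fixes A :: "real ^ 'n ^ 'n"
  assumes "transpose A = A"
  shows "x \<bullet> (A *v y) = (A *v x) \<bullet> y"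
  using assms by (metis dot_lmul_matrix transpose_matrix_vector)

text \<open>
  Eigenvectors for different eigenvalues are orthogonal, and a pairwise orthogonal set in a
  finite-dimensional space is finite.
\<close>

lemma finite_eigenvalues_symmetric:
  fixes A :: "real ^ 'n ^ 'n"
  assumes sym: "transpose A = A"
  shows "finite (eigenvalues A)"
proof -
  have "\<forall>l\<in>eigenvalues A. \<exists>v. v \<noteq> 0 \<and> A *v v = l *\<^sub>R v"
    by (simp add: eigenvalues_def)
  then obtain v where v: "\<And>l. l \<in> eigenvalues A \<Longrightarrow> v l \<noteq> 0 \<and> A *v v l = l *\<^sub>R v l"
    by metis
  have orth: "v l \<bullet> v m = 0" if "l \<in> eigenvalues A" "m \<in> eigenvalues A" "l \<noteq> m" for l m
  proof -
    have "m * (v l \<bullet> v m) = l * (v l \<bullet> v m)"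
      using symmetric_matrix_selfadjoint[OF sym, of "v l" "v m"] v that by simp
    with that show ?thesis by simp
  qed
  have "pairwise orthogonal (v ` eigenvalues A)"
    unfolding pairwise_def orthogonal_def using orth by blast
  then have "finite (v ` eigenvalues A)"
    by (rule pairwise_orthogonal_imp_finite)
  moreover have "inj_on v (eigenvalues A)"
    by (rule inj_onI) (metis orth v inner_eq_zero_iff)
  ultimately show ?thesis by (rule finite_imageD)
qed

text \<open>
  If no eigenvalue were positive, the quadratic form of \<open>A\<close> would be both nonnegative and nonpositive,
  hence zero, and a symmetric matrix is determined by its quadratic form.
\<close>

lemma psd_nonzero_has_positive_eigenvalue:
  fixes A :: "real ^ 'n ^ 'n"
  assumes psd: "positive_semidefinite A" and "A \<noteq> 0"
  shows "\<exists>l\<in>eigenvalues A. 0 < l"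
proof (rule ccontr)
  assume no_pos: "\<not> ?thesis"
  have selfadj: "x \<bullet> (A *v y) = (A *v x) \<bullet> y" for x y
    using psd by (simp add: positive_semidefinite_def symmetric_matrix_selfadjoint)
  have "0 \<le> x \<bullet> - (A *v x)" for x
  proof (rule commuting_selfadjoint_nonneg[where f = "(*v) A"])
    fix v l k
    assume v: "v \<noteq> 0" "A *v v = l *\<^sub>R v" "- (A *v v) = k *\<^sub>R v"
    then have "l \<le> 0" using no_pos by (force simp: eigenvalues_def not_less)
    moreover have "(- l) *\<^sub>R v = k *\<^sub>R v" using v by simp
    then have "- l = k" using v(1) by (metis scaleR_cancel_right)
    ultimately show "0 \<le> k" by simp
  next
    show "linear (\<lambda>v. - (A *v v))"
      by (rule linearI) (simp_all add: matrix_vector_right_distrib matrix_vector_mult_scaleR)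
    show "A *v - (A *v v) = - (A *v (A *v v))" for v
      using matrix_vector_mult_diff_distrib[of A 0 "A *v v"] by simp
  qed (auto simp: selfadj)
  then have zero: "x \<bullet> (A *v x) = 0" for x
    using psd by (simp add: positive_semidefinite_def order_antisym)
  have "A *v x = 0" for x
    using zero[of "x + A *v x"] zero[of x] zero[of "A *v x"] selfadj[of x "A *v x"]
    by (simp add: matrix_vector_right_distrib inner_simps)
  then have "A = 0" by (simp add: matrix_eq)
  with \<open>A \<noteq> 0\<close> show False by simp
qed

text \<open>
  One gradient step of length \<open>1 / lambda_max Q\<close> multiplies the component of the error along an
  eigenvector with eigenvalue \<open>l\<close> by \<open>1 - l / lambda_max Q\<close>. Components with \<open>l = 0\<close> are not contracted
  but do not count in the quadratic form of \<open>Q\<close>; all others are contracted by at least the factor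
  claimed.
\<close>

lemma psd_step_contraction:
  fixes Q :: "real ^ 'n ^ 'n" and e :: "real ^ 'n"
  assumes psd: "positive_semidefinite Q" and nonzero: "Q \<noteq> 0"
  defines "L \<equiv> lambda_max Q"
  defines "r \<equiv> 1 - lambda_min_pos Q / L"
    and "e' \<equiv> e - (1 / L) *\<^sub>R (Q *v e)"
  shows "e' \<bullet> (Q *v e') \<le> r\<^sup>2 * (e \<bullet> (Q *v e))"
proof -
  have sym: "transpose Q = Q" and nonneg: "0 \<le> v \<bullet> (Q *v v)" for v
    using psd by (auto simp: positive_semidefinite_def)
  note selfadj = symmetric_matrix_selfadjoint[OF sym]
  have fin: "finite (eigenvalues Q)" using sym by (rule finite_eigenvalues_symmetric)
  have le_L: "l \<le> L" if "l \<in> eigenvalues Q" for l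
    using that fin by (simp add: L_def lambda_max_def)
  have ge_mu: "lambda_min_pos Q \<le> l" if "l \<in> eigenvalues Q" "0 < l" for l
    using that fin by (simp add: lambda_min_pos_def)
  have L_pos: "0 < L"
    using psd_nonzero_has_positive_eigenvalue[OF psd nonzero] le_L by force
  define T where "T v = v - (1 / L) *\<^sub>R (Q *v v)" for v
  define M where "M v = r\<^sup>2 *\<^sub>R (Q *v v) - Q *v T (T v)" for v
  have linT: "linear T"
    by (rule linearI) (simp_all add: T_def algebra_simps)
  interpret T: linear T by (fact linT)
  have T_selfadj: "x \<bullet> T y = T x \<bullet> y" for x y
    by (simp add: T_def inner_simps selfadj)
  have QT: "Q *v T v = T (Q *v v)" for v
    by (simp add: T_def matrix_vector_mult_diff_distrib matrix_vector_mult_scaleR)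
  have "0 \<le> e \<bullet> M e"
  proof (rule commuting_selfadjoint_nonneg[where f = "(*v) Q"])
    show "linear M"
      by (rule linearI) (simp_all add: M_def T.add T.scale algebra_simps)
    show "x \<bullet> M y = M x \<bullet> y" for x y
      by (simp add: M_def inner_simps selfadj T_selfadj QT)
    show "Q *v M x = M (Q *v x)" for x
      by (simp add: M_def matrix_vector_mult_diff_distrib matrix_vector_mult_scaleR QT)
  next
    fix v l k
    assume v: "v \<noteq> 0" "Q *v v = l *\<^sub>R v" "M v = k *\<^sub>R v"
    have l: "l \<in> eigenvalues Q" using v by (auto simp: eigenvalues_def)
    have "0 \<le> l * (v \<bullet> v)" using nonneg[of v] v by simp
    then have "0 \<le> l" using v(1) by (metis inner_gt_zero_iff not_le zero_le_mult_iff)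
    have Tv: "T v = (1 - l / L) *\<^sub>R v"
      by (simp add: T_def v algebra_simps)
    have "Q *v T (T v) = (l * (1 - l / L)\<^sup>2) *\<^sub>R v"
      by (simp add: Tv T.scale matrix_vector_mult_scaleR v(2) power2_eq_square mult_ac)
    then have "M v = (l * (r\<^sup>2 - (1 - l / L)\<^sup>2)) *\<^sub>R v"
      by (simp add: M_def v(2) right_diff_distrib scaleR_left_diff_distrib mult.commute)
    then have k: "k = l * (r\<^sup>2 - (1 - l / L)\<^sup>2)"
      using v by (metis scaleR_cancel_right)
    show "0 \<le> k"
    proof (cases "l = 0")
      case False
      with \<open>0 \<le> l\<close> have "lambda_min_pos Q \<le> l" using ge_mu l by simp
      then have "1 - l / L \<le> r" using L_pos by (simp add: r_def divide_right_mono)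
      moreover have "0 \<le> 1 - l / L" using le_L[OF l] L_pos by simp
      ultimately have "(1 - l / L)\<^sup>2 \<le> r\<^sup>2" by (intro power_mono)
      with \<open>0 \<le> l\<close> show ?thesis by (simp add: k)
    qed (simp add: k)
  qed (auto simp: selfadj)
  then have "T e \<bullet> (Q *v T e) \<le> r\<^sup>2 * (e \<bullet> (Q *v e))"
    by (simp add: M_def inner_simps QT T_selfadj)
  then show ?thesis by (simp add: T_def e'_def)
qed

section \<open>Quadratic functions and exact line search\<close>

lemma quadratic_expansion:
  fixes Q :: "real ^ 'n ^ 'n" and c :: "real ^ 'n"
  assumes sym: "transpose Q = Q" and f: "f = (\<lambda>y. 1 / 2 * (y \<bullet> (Q *v y)) + c \<bullet> y)"
  shows "f (x + h) = f x + (Q *v x + c) \<bullet> h + 1 / 2 * (h \<bullet> (Q *v h))"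
  using symmetric_matrix_selfadjoint[OF sym, of x h]
  by (simp add: f matrix_vector_right_distrib inner_simps inner_commute algebra_simps)

lemma gradient_quadratic:
  fixes Q :: "real ^ 'n ^ 'n" and c :: "real ^ 'n"
  assumes sym: "transpose Q = Q" and f: "f = (\<lambda>y. 1 / 2 * (y \<bullet> (Q *v y)) + c \<bullet> y)"
  shows "gradient f x = Q *v x + c"
proof -
  note Q_deriv = bounded_linear.has_derivative[OF matrix_vector_mul_bounded_linear has_derivative_ident]
  have "(f has_derivative (\<lambda>h. 1 / 2 * (x \<bullet> (Q *v h) + h \<bullet> (Q *v x)) + c \<bullet> h)) (at x)"
    unfolding f
    by (intro has_derivative_add has_derivative_mult_right has_derivative_inner
        has_derivative_inner_right has_derivative_ident Q_deriv)
  also have "(\<lambda>h. 1 / 2 * (x \<bullet> (Q *v h) + h \<bullet> (Q *v x)) + c \<bullet> h) = (\<lambda>h. h \<bullet> (Q *v x + c))"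
    by (simp add: fun_eq_iff symmetric_matrix_selfadjoint[OF sym, of x] inner_add_right
        inner_commute[of "Q *v x"] inner_commute[of c])
  finally have "GDERIV f x :> Q *v x + c" by (simp add: gderiv_def)
  moreover have "g = Q *v x + c" if "GDERIV f x :> g" for g
  proof -
    have "(\<lambda>h. h \<bullet> g) = (\<lambda>h. h \<bullet> (Q *v x + c))"
      using that \<open>GDERIV f x :> Q *v x + c\<close> unfolding gderiv_def by (rule has_derivative_unique)
    then show ?thesis by (metis vector_eq_ldot)
  qed
  ultimately show ?thesis unfolding gradient_def by (rule the_equality)
qed

lemma quadratic_minimizer_stationary:
  fixes Q :: "real ^ 'n ^ 'n" and c :: "real ^ 'n"
  assumes sym: "transpose Q = Q" and f: "f = (\<lambda>y. 1 / 2 * (y \<bullet> (Q *v y)) + c \<bullet> y)"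
    and min: "is_arg_min f (\<lambda>_. True) xstar"
  shows "Q *v xstar + c = 0"
proof -
  let ?g = "Q *v xstar + c"
  have "?g \<bullet> ?g = 0"
  proof (rule nonneg_quadratic_linear_term_zero)
    fix t
    have "f xstar \<le> f (xstar + t *\<^sub>R ?g)"
      using min by (simp add: is_arg_min_linorder)
    then show "0 \<le> t * (?g \<bullet> ?g) + t\<^sup>2 * (1 / 2 * (?g \<bullet> (Q *v ?g)))"
      unfolding quadratic_expansion[OF sym f]
      by (simp add: matrix_vector_mult_scaleR power2_eq_square)
  qed
  then show ?thesis by simp
qed

theorem corollary1:
  fixes Q :: "real ^ 'n ^ 'n" and c :: "real ^ 'n"
    and f :: "real ^ 'n \<Rightarrow> real"
    and xstar x0 :: "real ^ 'n" and x :: "nat \<Rightarrow> real ^ 'n" and i :: nat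
  assumes "positive_semidefinite Q" and "Q \<noteq> 0"
    and "f = (\<lambda>y. 1 / 2 * (y \<bullet> (Q *v y)) + c \<bullet> y)"
    and "is_arg_min f (\<lambda>_. True) xstar"
    and "exact_line_search_sequence f x0 x"
  shows "f (x (Suc i)) - f xstar
           \<le> (1 - lambda_min_pos Q / lambda_max Q)\<^sup>2 * (f (x i) - f xstar)"
proof -
  have sym: "transpose Q = Q" using assms(1) by (simp add: positive_semidefinite_def)
  have stationary: "Q *v xstar + c = 0"
    using quadratic_minimizer_stationary[OF sym assms(3,4)] .
  have excess: "f (xstar + e) - f xstar = 1 / 2 * (e \<bullet> (Q *v e))" for e
    using quadratic_expansion[OF sym assms(3), of xstar e] stationary by simp
  define e where "e = x i - xstar"
  define e' where "e' = e - (1 / lambda_max Q) *\<^sub>R (Q *v e)"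
  have xi: "x i = xstar + e" by (simp add: e_def)
  have grad: "gradient f (x i) = Q *v e"
    using gradient_quadratic[OF sym assms(3), of "x i"] stationary
    by (simp add: xi matrix_vector_right_distrib add.commute add.left_commute)
  obtain s where "is_arg_min (\<lambda>t. f (x i - t *\<^sub>R gradient f (x i))) (\<lambda>_. True) s"
    and "x (Suc i) = x i - s *\<^sub>R gradient f (x i)"
    using assms(5) unfolding exact_line_search_sequence_def by blast
  then have "f (x (Suc i)) \<le> f (x i - (1 / lambda_max Q) *\<^sub>R gradient f (x i))"
    by (simp add: is_arg_min_linorder)
  also have "\<dots> = f (xstar + e')" by (simp only: grad) (simp add: xi e'_def algebra_simps)
  finally have "f (x (Suc i)) - f xstar \<le> 1 / 2 * (e' \<bullet> (Q *v e'))"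
    using excess[of e'] by simp
  also have "\<dots> \<le> (1 - lambda_min_pos Q / lambda_max Q)\<^sup>2 * (1 / 2 * (e \<bullet> (Q *v e)))"
    using psd_step_contraction[OF assms(1,2), of e] by (simp add: e'_def)
  also have "1 / 2 * (e \<bullet> (Q *v e)) = f (x i) - f xstar"
    using excess[of e] by (simp add: xi)
  finally show ?thesis .
qed

end
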